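(* Let $\eta\ge1$, let $d,m\ge1$ and positive integers $(d_u,T_u)_{u=1}^m$ satisfy $d_u\le T_u$ for all $u$ and $\sum_ud_u\le d$, and let $c\ge\max_ud_u/T_u$. Then there exists an oblivious adversary such that: (1) its ground truth $\theta^*\in\mathbb{R}^d$ satisfies $\|\theta^*\|_2\le\sqrt d$ and $|\langle\theta^*,x_t\rangle|\le1$ for all $t$, and the noise is independent, zero-mean, sub-Gaussian with variance proxy $\eta^2$; (2) its sequence $x_1,\dots,x_T$ ($T=\sum_uT_u$, $\|x_t\|_2\le1$) admits a partition of $[T]$ into disjoint nonempty $I_1,\dots,I_m$ with $|I_u|=T_u$ and $\{x_t:t\in I_u\}$ in a subspace of dimension $d_u$; (3) every online active learning algorithm has expected total cost $\mathbb{E}[W]\ge c'\sqrt c\sum_{u=1}^m\sqrt{d_uT_u}$ for an absolute constant $c'>0$.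
   Context: Online active regression protocol: an oblivious adversary fixes $\theta^*$ and $x_1,\dots,x_T$ in advance; labels $y_t=\langle\theta^*,x_t\rangle+\xi_t$; at each round the learner sees $x_t$, predicts $\hat y_t$ using only past observations, then decides whether to query $y_t$. Regret $R=\sum_t(\hat y_t-\langle\theta^*,x_t\rangle)^2$, queries $Q=\sum_tq_t$. In the $c$-cost model with cost ratio $c>0$, the total cost is $W=cR+Q$.
   Formalization: The adversary draws θ* at random in advance from a prior independent of learner and noise; (1) holds almost surely and E[W] averages over θ* too, since for one fixed θ* the learner predicting ⟨θ*,x_t⟩ without querying has W=0. *)

theory Defs
  imports "HOL-Probability.Probability"
begin

text \<open>Vectors of R^d are represented as functions nat => real; only the
  coordinates i < d are meaningful (R^d-vectors are required to vanish at i >= d).\<close>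
type_synonym vec = "nat \<Rightarrow> real"

text \<open>History seen by the learner: for each past round s, the feature vector x_s
  and the observed label (Some y_s if it was queried, None otherwise).\<close>
type_synonym hist = "(vec \<times> real option) list"

definition ip :: "nat \<Rightarrow> vec \<Rightarrow> vec \<Rightarrow> real" where
  "ip d a b = (\<Sum>i<d. a i * b i)"

definition vnorm :: "nat \<Rightarrow> vec \<Rightarrow> real" where
  "vnorm d a = sqrt (\<Sum>i<d. (a i)^2)"

definition in_Rd :: "nat \<Rightarrow> vec \<Rightarrow> bool" where
  "in_Rd d v \<longleftrightarrow> (\<forall>i\<ge>d. v i = 0)"

definition span_vecs :: "nat \<Rightarrow> nat \<Rightarrow> (nat \<Rightarrow> vec) \<Rightarrow> vec set" where
  "span_vecs d k b = {v. in_Rd d v \<and> (\<exists>a::nat \<Rightarrow> real. \<forall>i<d. v i = (\<Sum>j<k. a j * b j i))}"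

definition lin_indep_vecs :: "nat \<Rightarrow> nat \<Rightarrow> (nat \<Rightarrow> vec) \<Rightarrow> bool" where
  "lin_indep_vecs d k b \<longleftrightarrow>
     (\<forall>a::nat \<Rightarrow> real. (\<forall>i<d. (\<Sum>j<k. a j * b j i) = 0) \<longrightarrow> (\<forall>j<k. a j = 0))"

definition in_subspace_of_dim :: "nat \<Rightarrow> nat \<Rightarrow> vec set \<Rightarrow> bool" where
  "in_subspace_of_dim d k S \<longleftrightarrow>
     (\<exists>b. (\<forall>j<k. in_Rd d (b j)) \<and> lin_indep_vecs d k b \<and> S \<subseteq> span_vecs d k b)"

definition zero_mean_subgaussian :: "real \<Rightarrow> real measure \<Rightarrow> bool" where
  "zero_mean_subgaussian \<sigma> M \<longleftrightarrow>
     prob_space M \<and> sets M = sets borel \<and>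
     integrable M (\<lambda>x. x) \<and> (\<integral>x. x \<partial>M) = 0 \<and>
     (\<forall>l::real. integrable M (\<lambda>x. exp (l * x)) \<and>
        (\<integral>x. exp (l * x) \<partial>M) \<le> exp (l^2 * \<sigma>^2 / 2))"

text \<open>Online active learning algorithm with random seed r (drawn from an arbitrary
  distribution on the reals, chosen by the algorithm): at round t it sees the
  history H of past rounds and the current x_t, predicts pred r H x_t, and
  decides whether to query the label, qry r H x_t (this may use its own prediction,
  which is a function of the same data).  The protocol, given ground truth theta,
  features X, noise xi and seed r, generates the history before round t:\<close>
fun history ::
  "(real \<Rightarrow> hist \<Rightarrow> vec \<Rightarrow> bool) \<Rightarrow> nat \<Rightarrow> (nat \<Rightarrow> vec) \<Rightarrow> vec \<Rightarrow> (nat \<Rightarrow> real) \<Rightarrow> real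
     \<Rightarrow> nat \<Rightarrow> hist" where
  "history qry d X \<theta> \<xi> r 0 = []"
| "history qry d X \<theta> \<xi> r (Suc t) =
     (let H = history qry d X \<theta> \<xi> r t in
       H @ [(X t, if qry r H (X t) then Some (ip d \<theta> (X t) + \<xi> t) else None)])"

definition regret ::
  "(real \<Rightarrow> hist \<Rightarrow> vec \<Rightarrow> real) \<Rightarrow> (real \<Rightarrow> hist \<Rightarrow> vec \<Rightarrow> bool) \<Rightarrow> nat \<Rightarrow> nat
     \<Rightarrow> (nat \<Rightarrow> vec) \<Rightarrow> vec \<Rightarrow> (nat \<Rightarrow> real) \<Rightarrow> real \<Rightarrow> real" where
  "regret pred qry d T X \<theta> \<xi> r =
     (\<Sum>t<T. (pred r (history qry d X \<theta> \<xi> r t) (X t) - ip d \<theta> (X t))^2)"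

definition num_queries ::
  "(real \<Rightarrow> hist \<Rightarrow> vec \<Rightarrow> bool) \<Rightarrow> nat \<Rightarrow> nat
     \<Rightarrow> (nat \<Rightarrow> vec) \<Rightarrow> vec \<Rightarrow> (nat \<Rightarrow> real) \<Rightarrow> real \<Rightarrow> real" where
  "num_queries qry d T X \<theta> \<xi> r =
     (\<Sum>t<T. if qry r (history qry d X \<theta> \<xi> r t) (X t) then 1 else 0)"

definition total_cost ::
  "real \<Rightarrow> (real \<Rightarrow> hist \<Rightarrow> vec \<Rightarrow> real) \<Rightarrow> (real \<Rightarrow> hist \<Rightarrow> vec \<Rightarrow> bool) \<Rightarrow> nat \<Rightarrow> nat
     \<Rightarrow> (nat \<Rightarrow> vec) \<Rightarrow> vec \<Rightarrow> (nat \<Rightarrow> real) \<Rightarrow> real \<Rightarrow> real" where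
  "total_cost c pred qry d T X \<theta> \<xi> r =
     c * regret pred qry d T X \<theta> \<xi> r + num_queries qry d T X \<theta> \<xi> r"

end

theory Submission
  imports Defs
begin

text \<open>
  The rounds of a block are dealt out evenly to its \<open>d\<^sub>u\<close> coordinates; a round for coordinate \<open>j\<close>
  shows the unit vector \<open>e\<^sub>j\<close>.  If coordinate \<open>j\<close> gets \<open>n\<close> rounds, its prior is uniform on
  \<open>{\<delta>, - \<delta>}\<close> with \<open>\<delta>^4 = 1 / (2 c n)\<close>; the noise is standard Gaussian.  Under the Gaussian law of
  the labels for \<open>\<theta>\<^sub>j = 0\<close>, let \<open>L\<^sub>+\<close> and \<open>L\<^sub>-\<close> be the likelihood ratios of the two alternatives, which
  only involve queried labels, and \<open>M = (L\<^sub>+ + L\<^sub>-) / 2\<close>.  Then \<open>sqrt (L\<^sub>+ L\<^sub>-) = exp (- \<delta>^2 Q / 2)\<close>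
  with \<open>Q\<close> the number of queries so far, so this Hellinger affinity drops by at most \<open>\<delta>^2 M / 2\<close>
  per query, while the averaged squared loss of any prediction is at least
  \<open>\<delta>^2 (2 sqrt (L\<^sub>+ L\<^sub>-) - M)\<close>.  Both bounds hold pointwise and are linear in quantities with known
  expectation: integrating gives an expected loss of at least \<open>\<delta>^2 (1 - \<delta>^2 E Q)\<close> per round, hence a
  cost of at least \<open>c n \<delta>^2 + (1 - c n \<delta>^4) E Q\<close>, which is at least \<open>sqrt (c n / 2)\<close>.
\<close>

section \<open>Standard Gaussian noise: the shift formula and sub-Gaussianity\<close>

abbreviation gauss :: "real measure" where
  "gauss \<equiv> density lborel (\<lambda>x. ennreal (std_normal_density x))"

lemma std_normal_density_shift:
  "std_normal_density (x - a) = std_normal_density x * exp (a * x - a\<^sup>2 / 2)"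
  by (simp add: std_normal_density_def exp_add [symmetric] mult.assoc)
     (simp add: field_simps power2_eq_square)

text \<open>The one-dimensional Cameron-Martin formula: translation invariance of
  \<open>lborel\<close> moves the shift from the argument of \<open>f\<close> to the
  density.\<close>

lemma nn_integral_gauss_shift:
  assumes [measurable]: "f \<in> borel_measurable borel"
  shows "(\<integral>\<^sup>+x. f (x + a) \<partial>gauss) = (\<integral>\<^sup>+x. f x * ennreal (exp (a * x - a\<^sup>2 / 2)) \<partial>gauss)"
proof -
  have "(\<integral>\<^sup>+x. f (x + a) \<partial>gauss) = (\<integral>\<^sup>+x. ennreal (std_normal_density x) * f (x + a) \<partial>lborel)"
    by (simp add: nn_integral_density)
  also have "\<dots> = (\<integral>\<^sup>+x. ennreal (std_normal_density ((- a + 1 * x))) * f ((- a + 1 * x) + a) \<partial>lborel)"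
    by (subst nn_integral_real_affine[where c = 1 and t = "- a"]) simp_all
  also have "\<dots> = (\<integral>\<^sup>+x. ennreal (std_normal_density x) * (f x * ennreal (exp (a * x - a\<^sup>2 / 2))) \<partial>lborel)"
  proof (rule nn_integral_cong)
    fix x :: real
    show "ennreal (std_normal_density (- a + 1 * x)) * f (- a + 1 * x + a) =
      ennreal (std_normal_density x) * (f x * ennreal (exp (a * x - a\<^sup>2 / 2)))"
      using std_normal_density_shift[of x a] by (simp add: ennreal_mult ac_simps)
  qed
  also have "\<dots> = (\<integral>\<^sup>+x. f x * ennreal (exp (a * x - a\<^sup>2 / 2)) \<partial>gauss)"
    by (simp add: nn_integral_density)
  finally show ?thesis .
qed

lemma prob_space_gauss: "prob_space gauss"
  by (rule prob_space_normal_density) simp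

text \<open>The shift formula applied to the constant function 1 yields the moment generating
  function \<open>exp (l^2 / 2)\<close>; unit variance is within the proxy because
  \<open>\<eta> \<ge> 1\<close>.\<close>

lemma zero_mean_subgaussian_gauss:
  assumes "\<eta> \<ge> 1"
  shows "zero_mean_subgaussian \<eta> gauss"
proof -
  interpret prob_space gauss by (rule prob_space_gauss)
  have mgf: "(\<integral>\<^sup>+x. ennreal (exp (l * x)) \<partial>gauss) = ennreal (exp (l\<^sup>2 / 2))" for l
  proof -
    have "1 = (\<integral>\<^sup>+x. 1 * ennreal (exp (l * x - l\<^sup>2 / 2)) \<partial>gauss)"
      using nn_integral_gauss_shift[of "\<lambda>_. 1" l] emeasure_space_1 by simp
    also have "\<dots> = (\<integral>\<^sup>+x. ennreal (exp (- (l\<^sup>2 / 2))) * ennreal (exp (l * x)) \<partial>gauss)"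
      by (simp add: ennreal_mult[symmetric] exp_add[symmetric])
    also have "\<dots> = ennreal (exp (- (l\<^sup>2 / 2))) * (\<integral>\<^sup>+x. ennreal (exp (l * x)) \<partial>gauss)"
      by (rule nn_integral_cmult) simp
    finally have "ennreal (exp (l\<^sup>2 / 2)) = ennreal (exp (l\<^sup>2 / 2)) * ennreal (exp (- (l\<^sup>2 / 2))) *
        (\<integral>\<^sup>+x. ennreal (exp (l * x)) \<partial>gauss)"
      by (simp add: mult.assoc)
    then show ?thesis
      by (simp add: ennreal_mult[symmetric] exp_add[symmetric])
  qed
  have int: "integrable gauss (\<lambda>x. exp (l * x))" for l
    by (rule integrableI_nonneg) (auto simp: mgf)
  have "(\<integral>x. exp (l * x) \<partial>gauss) \<le> exp (l\<^sup>2 * \<eta>\<^sup>2 / 2)" for l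
  proof -
    have "(\<integral>x. exp (l * x) \<partial>gauss) = exp (l\<^sup>2 / 2)"
      by (subst integral_eq_nn_integral) (auto simp: mgf)
    also have "1 \<le> \<eta>\<^sup>2" using assms by simp
    then have "l\<^sup>2 * 1 \<le> l\<^sup>2 * \<eta>\<^sup>2" by (intro mult_left_mono) auto
    then have "exp (l\<^sup>2 / 2) \<le> exp (l\<^sup>2 * \<eta>\<^sup>2 / 2)" by simp
    finally show ?thesis .
  qed
  moreover have "integrable gauss (\<lambda>x. x)" "(\<integral>x. x \<partial>gauss) = 0"
    using integrable_normal_moment_nz_1[of 1 0] integral_std_normal_moment_odd[of 0]
      std_normal_moment_odd[of 0]
    by (auto simp: integrable_density integral_density has_bochner_integral_iff)
  ultimately show ?thesis
    unfolding zero_mean_subgaussian_def using int prob_space_gauss by simp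
qed

section \<open>Change of measure for adaptively shifted Gaussian noise\<close>

text \<open>Fubini isolates coordinate \<open>i\<close>; in the inner integral \<open>b\<close> and
  \<open>h\<close> are constant, so the one-dimensional formula applies. The weight \<open>h\<close>
  makes room for the density collected from earlier coordinates when single shifts are
  iterated.\<close>

lemma nn_integral_PiM_gauss_shift:
  fixes F h :: "('i \<Rightarrow> real) \<Rightarrow> ennreal"
  assumes "finite I" "i \<in> I"
    and F[measurable]: "F \<in> borel_measurable (PiM I (\<lambda>_. gauss))"
    and h[measurable]: "h \<in> borel_measurable (PiM I (\<lambda>_. gauss))"
    and b[measurable]: "Measurable.pred (PiM I (\<lambda>_. gauss)) b"
    and hi: "\<And>\<xi> x. h (\<xi>(i := x)) = h \<xi>" and bi: "\<And>\<xi> x. b (\<xi>(i := x)) = b \<xi>"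
  shows "(\<integral>\<^sup>+\<xi>. F (if b \<xi> then \<xi>(i := \<xi> i + a) else \<xi>) * h \<xi> \<partial>PiM I (\<lambda>_. gauss)) =
    (\<integral>\<^sup>+\<xi>. F \<xi> * (h \<xi> * ennreal (if b \<xi> then exp (a * \<xi> i - a\<^sup>2 / 2) else 1)) \<partial>PiM I (\<lambda>_. gauss))"
proof -
  interpret prob_space gauss by (rule prob_space_gauss)
  interpret product_sigma_finite "\<lambda>_::'i. gauss" by standard
  obtain K where K: "I = insert i K" "i \<notin> K" "finite K"
    using assms(1,2) by (metis finite_insert mk_disjoint_insert)
  have [measurable]: "(\<lambda>\<xi>. \<xi>(i := \<xi> i + a)) \<in> PiM I (\<lambda>_. gauss) \<rightarrow>\<^sub>M PiM I (\<lambda>_. gauss)"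
    using \<open>i \<in> I\<close> by (intro measurable_fun_upd[where J = I]) auto
  have [measurable]: "(\<lambda>\<xi>. \<xi> i) \<in> PiM I (\<lambda>_. gauss) \<rightarrow>\<^sub>M borel"
    using measurable_component_singleton[OF \<open>i \<in> I\<close>, of "\<lambda>_. gauss"] by simp
  have *: "(\<integral>\<^sup>+x. F (if b (\<xi>(i := x)) then (\<xi>(i := x))(i := (\<xi>(i := x)) i + a) else \<xi>(i := x)) * h (\<xi>(i := x)) \<partial>gauss) =
     (\<integral>\<^sup>+x. F (\<xi>(i := x)) * (h (\<xi>(i := x)) *
        ennreal (if b (\<xi>(i := x)) then exp (a * (\<xi>(i := x)) i - a\<^sup>2 / 2) else 1)) \<partial>gauss)"
    if \<xi>: "\<xi> \<in> space (PiM K (\<lambda>_. gauss))" for \<xi>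
  proof (cases "b \<xi>")
    case True
    have "(\<lambda>x. \<xi>(i := x)) \<in> gauss \<rightarrow>\<^sub>M PiM I (\<lambda>_. gauss)"
      unfolding K by (rule measurable_fun_upd[where J = K]) (use K \<xi> in auto)
    from measurable_compose[OF this F]
    have "(\<lambda>x. F (\<xi>(i := x)) * h \<xi>) \<in> borel_measurable borel" by simp
    from nn_integral_gauss_shift[OF this, of a] True show ?thesis
      by (simp add: hi bi mult.assoc)
  qed (simp add: hi bi)
  have split: "(\<integral>\<^sup>+\<xi>. g \<xi> \<partial>PiM I (\<lambda>_. gauss)) = (\<integral>\<^sup>+\<xi>. (\<integral>\<^sup>+x. g (\<xi>(i := x)) \<partial>gauss) \<partial>PiM K (\<lambda>_. gauss))"
    if "g \<in> borel_measurable (PiM I (\<lambda>_. gauss))" for g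
    using product_nn_integral_insert[OF K(3,2)] that unfolding K(1) by blast
  show ?thesis
    by (subst (1 2) split, measurable, intro nn_integral_cong *)
qed

text \<open>The decision \<open>b t\<close> to shift coordinate \<open>t\<close> is evaluated on the noise whose coordinates before
  \<open>t\<close> are already shifted; this turns the noise of the world \<open>\<theta>\<^sub>j = a\<close> into noise that produces the
  same history in the world \<open>\<theta>\<^sub>j = 0\<close>.\<close>

primrec adaptive_shift ::
  "(nat \<Rightarrow> (nat \<Rightarrow> real) \<Rightarrow> bool) \<Rightarrow> real \<Rightarrow> nat \<Rightarrow> (nat \<Rightarrow> real) \<Rightarrow> nat \<Rightarrow> real" where
  "adaptive_shift b a 0 \<xi> = \<xi>"
| "adaptive_shift b a (Suc t) \<xi> =
    (let \<zeta> = adaptive_shift b a t \<xi> in if b t \<zeta> then \<zeta>(t := \<zeta> t + a) else \<zeta>)"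

text \<open>The likelihood ratio of the world \<open>\<theta>\<^sub>j = a\<close> against
  \<open>\<theta>\<^sub>j = 0\<close> for the labels before round \<open>t\<close>; rounds without a
  query contribute a factor 1. Here \<open>b\<close> is evaluated at \<open>\<xi>\<close> itself,
  since after the change of measure \<open>\<xi>\<close> already stands for the shifted
  noise.\<close>

definition shift_density ::
  "(nat \<Rightarrow> (nat \<Rightarrow> real) \<Rightarrow> bool) \<Rightarrow> real \<Rightarrow> nat \<Rightarrow> (nat \<Rightarrow> real) \<Rightarrow> real" where
  "shift_density b a t \<xi> = (\<Prod>s<t. if b s \<xi> then exp (a * \<xi> s - a\<^sup>2 / 2) else 1)"

lemma shift_density_pos: "shift_density b a t \<xi> > 0"
  unfolding shift_density_def by (intro prod_pos) auto

lemma adaptive_shift_ge: "i \<ge> t \<Longrightarrow> adaptive_shift b a t \<xi> i = \<xi> i"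
  by (induction t) (auto simp: Let_def)

lemma measurable_shift_density:
  assumes "\<And>s. s < T \<Longrightarrow> Measurable.pred (PiM {..<T} (\<lambda>_. gauss)) (b s)" "t \<le> T"
  shows "shift_density b a t \<in> borel_measurable (PiM {..<T} (\<lambda>_. gauss))"
  unfolding shift_density_def
proof (rule borel_measurable_prod)
  fix s assume "s \<in> {..<t}"
  then have s: "s < T" using assms(2) by simp
  have [measurable]: "(\<lambda>\<xi>. \<xi> s) \<in> PiM {..<T} (\<lambda>_. gauss) \<rightarrow>\<^sub>M borel"
    using measurable_component_singleton[of s "{..<T}" "\<lambda>_. gauss"] s by simp
  note assms(1)[OF s, measurable]
  show "(\<lambda>\<xi>. if b s \<xi> then exp (a * \<xi> s - a\<^sup>2 / 2) else 1) \<in> borel_measurable (PiM {..<T} (\<lambda>_. gauss))"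
    by measurable
qed

lemma measurable_adaptive_shift:
  assumes b: "\<And>s. s < T \<Longrightarrow> Measurable.pred (PiM {..<T} (\<lambda>_. gauss)) (b s)" and "t \<le> T"
  shows "adaptive_shift b a t \<in> PiM {..<T} (\<lambda>_. gauss) \<rightarrow>\<^sub>M PiM {..<T} (\<lambda>_. gauss)"
  using \<open>t \<le> T\<close>
proof (induction t)
  case 0
  have "adaptive_shift b a 0 = (\<lambda>\<xi>. \<xi>)" by auto
  then show ?case by (metis measurable_ident_sets)
next
  case (Suc t)
  let ?P = "PiM {..<T} (\<lambda>_. gauss)"
  have t: "t < T" "t \<in> {..<T}" using Suc.prems by auto
  have IH: "adaptive_shift b a t \<in> ?P \<rightarrow>\<^sub>M ?P" using Suc by simp
  note [measurable] = b[OF t(1)]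
  have [measurable]: "(\<lambda>\<xi>. \<xi> t) \<in> ?P \<rightarrow>\<^sub>M borel"
    using measurable_component_singleton[OF t(2), of "\<lambda>_. gauss"] by simp
  have [measurable]: "(\<lambda>\<xi>. \<xi>(t := \<xi> t + a)) \<in> ?P \<rightarrow>\<^sub>M ?P"
    using t by (intro measurable_fun_upd[where J = "{..<T}"]) auto
  have "(\<lambda>\<zeta>. if b t \<zeta> then \<zeta>(t := \<zeta> t + a) else \<zeta>) \<in> ?P \<rightarrow>\<^sub>M ?P"
    by measurable
  from measurable_compose[OF IH this] show ?case by (simp add: Let_def cong: if_cong)
qed

text \<open>Girsanov's formula in discrete time. The shift in round \<open>t\<close> moves
  coordinate \<open>t\<close> alone, and by \<open>past\<close> neither the decision
  \<open>b t\<close> nor the density of the earlier rounds looks at this coordinate, so the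
  single-coordinate formula can be iterated.\<close>

lemma nn_integral_adaptive_shift:
  assumes b: "\<And>s. s < T \<Longrightarrow> Measurable.pred (PiM {..<T} (\<lambda>_. gauss)) (b s)"
    and past: "\<And>s \<xi> \<zeta>. (\<And>i. i < s \<Longrightarrow> \<xi> i = \<zeta> i) \<Longrightarrow> b s \<xi> = b s \<zeta>"
    and "t \<le> T" and "G \<in> borel_measurable (PiM {..<T} (\<lambda>_. gauss))"
  shows "(\<integral>\<^sup>+\<xi>. G (adaptive_shift b a t \<xi>) \<partial>PiM {..<T} (\<lambda>_. gauss)) =
    (\<integral>\<^sup>+\<xi>. G \<xi> * ennreal (shift_density b a t \<xi>) \<partial>PiM {..<T} (\<lambda>_. gauss))"
  using assms(3,4)
proof (induction t arbitrary: G)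
  case 0
  then show ?case by (simp add: shift_density_def)
next
  case (Suc t)
  let ?P = "PiM {..<T} (\<lambda>_. gauss)"
  have t: "t < T" "t \<in> {..<T}" using Suc.prems by auto
  note [measurable] = b[OF t(1)] Suc.prems(2)
  have [measurable]: "shift_density b a t \<in> borel_measurable ?P"
    using b t by (intro measurable_shift_density) auto
  have [measurable]: "(\<lambda>\<xi>. \<xi> t) \<in> ?P \<rightarrow>\<^sub>M borel"
    using measurable_component_singleton[OF t(2), of "\<lambda>_. gauss"] by simp
  have [measurable]: "(\<lambda>\<xi>. \<xi>(t := \<xi> t + a)) \<in> ?P \<rightarrow>\<^sub>M ?P"
    using t by (intro measurable_fun_upd[where J = "{..<T}"]) auto
  let ?\<Psi> = "\<lambda>\<xi>. if b t \<xi> then \<xi>(t := \<xi> t + a) else \<xi>"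
  have "(\<integral>\<^sup>+\<xi>. G (adaptive_shift b a (Suc t) \<xi>) \<partial>?P) = (\<integral>\<^sup>+\<xi>. G (?\<Psi> (adaptive_shift b a t \<xi>)) \<partial>?P)"
    by (simp add: Let_def)
  \<comment> \<open>The last shift is absorbed into the integrand, which is why the induction
    generalizes over \<open>G\<close>.\<close>
  also have "\<dots> = (\<integral>\<^sup>+\<xi>. G (?\<Psi> \<xi>) * ennreal (shift_density b a t \<xi>) \<partial>?P)"
    by (rule Suc.IH[of "\<lambda>\<xi>. G (?\<Psi> \<xi>)"]) (use t in \<open>auto\<close>)
  also have "\<dots> = (\<integral>\<^sup>+\<xi>. G \<xi> * (ennreal (shift_density b a t \<xi>) *
      ennreal (if b t \<xi> then exp (a * \<xi> t - a\<^sup>2 / 2) else 1)) \<partial>?P)"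
  proof (rule nn_integral_PiM_gauss_shift)
    fix \<xi> x
    show "b t (\<xi>(t := x)) = b t \<xi>" by (rule past) auto
    have "b s (\<xi>(t := x)) = b s \<xi>" if "s < t" for s by (rule past) (use that in auto)
    then show "ennreal (shift_density b a t (\<xi>(t := x))) = ennreal (shift_density b a t \<xi>)"
      unfolding shift_density_def by (intro arg_cong[where f = ennreal] prod.cong) auto
  qed (use t in auto)
  also have "\<dots> = (\<integral>\<^sup>+\<xi>. G \<xi> * ennreal (shift_density b a (Suc t) \<xi>) \<partial>?P)"
    by (intro nn_integral_cong) (simp add: shift_density_def ennreal_mult[symmetric] prod_nonneg)
  finally show ?case .
qed

section \<open>Identical histories in two worlds\<close>

lemma history_cong:
  "(\<And>i. i < t \<Longrightarrow> \<xi> i = \<zeta> i) \<Longrightarrow> history qry d X \<theta> \<xi> r t = history qry d X \<theta> \<zeta> r t"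
  by (induction t) (auto simp: Let_def)

text \<open>A queried label for coordinate \<open>j\<close> is \<open>a + \<xi> t\<close> in one
  world and \<open>0 + (\<xi> t + a)\<close> in the other; all other queried labels agree, and
  unqueried ones are never seen. Coordinate \<open>t\<close> is still untouched when round
  \<open>t\<close> begins, by \<open>adaptive_shift_ge\<close>.\<close>

lemma history_adaptive_shift:
  assumes b: "b = (\<lambda>t \<xi>. f t = j \<and> qry r (history qry d X \<theta> \<xi> r t) (X t))"
    and ip: "\<And>\<theta> t. t < T \<Longrightarrow> ip d \<theta> (X t) = \<theta> (f t)" and "\<theta> j = 0" and "t \<le> T"
  shows "history qry d X (\<theta>(j := a)) \<xi> r t = history qry d X \<theta> (adaptive_shift b a t \<xi>) r t"
  using \<open>t \<le> T\<close>
proof (induction t)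
  case (Suc t)
  have "history qry d X \<theta> (adaptive_shift b a (Suc t) \<xi>) r t = history qry d X \<theta> (adaptive_shift b a t \<xi>) r t"
    by (rule history_cong) (auto simp: Let_def)
  then show ?case
    using Suc \<open>\<theta> j = 0\<close> adaptive_shift_ge[of t t b a \<xi>] ip[of t]
    by (auto simp: Let_def b)
qed simp

section \<open>Pointwise inequalities for the two likelihood ratios\<close>

text \<open>The difference of the two sides is a sum of two squares. In the application
  \<open>u\<close> and \<open>v\<close> are the square roots of the likelihood ratios, so that
  \<open>u * v\<close> is the pointwise Hellinger affinity.\<close>

lemma two_point_square_loss:
  fixes p \<delta> u v :: real
  shows "((p - \<delta>)\<^sup>2 * u\<^sup>2 + (p + \<delta>)\<^sup>2 * v\<^sup>2) / 2 + \<delta>\<^sup>2 * ((u\<^sup>2 + v\<^sup>2) / 2) \<ge> 2 * \<delta>\<^sup>2 * (u * v)"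
proof -
  have "0 \<le> (p * (u + v) - 2 * \<delta> * (u - v))\<^sup>2 / 4 + (p * (u - v))\<^sup>2 / 4" by simp
  also have "\<dots> = ((p - \<delta>)\<^sup>2 * u\<^sup>2 + (p + \<delta>)\<^sup>2 * v\<^sup>2) / 2 + \<delta>\<^sup>2 * ((u\<^sup>2 + v\<^sup>2) / 2) - 2 * \<delta>\<^sup>2 * (u * v)"
    by (simp add: power2_eq_square field_simps)
  finally show ?thesis by (simp only: diff_ge_0_iff_ge)
qed

text \<open>The terms linear in the noise cancel in the exponents, so the noise enters only through
  which rounds are queried.\<close>

lemma shift_density_mult_neg:
  "shift_density b a t \<xi> * shift_density b (- a) t \<xi> = (\<Prod>s<t. if b s \<xi> then exp (- a\<^sup>2) else 1)"
  unfolding shift_density_def prod.distrib[symmetric]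
  by (intro prod.cong) (auto simp: exp_add[symmetric])

text \<open>A query multiplies the affinity by \<open>exp (- a\<^sup>2 / 2)\<close>, which is at
  least \<open>1 - a\<^sup>2 / 2\<close>; the amount lost is then bounded through the
  arithmetic-geometric mean inequality. Replacing the affinity by the mean of the two ratios makes
  the error linear in them, so it integrates to an expected number of queries.\<close>

lemma sqrt_shift_density_ge:
  "sqrt (shift_density b a t \<xi> * shift_density b (- a) t \<xi>) \<ge>
    1 - a\<^sup>2 / 2 * (\<Sum>s<t. of_bool (b s \<xi>) * ((shift_density b a s \<xi> + shift_density b (- a) s \<xi>) / 2))"
proof (induction t)
  case 0
  then show ?case by (simp add: shift_density_def)
next
  case (Suc t)
  let ?E = "\<lambda>t. sqrt (shift_density b a t \<xi> * shift_density b (- a) t \<xi>)"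
  let ?M = "(shift_density b a t \<xi> + shift_density b (- a) t \<xi>) / 2"
  have E: "0 \<le> ?E t" "?E t \<le> ?M"
    using less_imp_le[OF shift_density_pos[of b _ t \<xi>]] arith_geo_mean_sqrt by auto
  have "?E (Suc t) \<ge> ?E t - a\<^sup>2 / 2 * (of_bool (b t \<xi>) * ?M)"
  proof (cases "b t \<xi>")
    case True
    have "?E (Suc t) = ?E t * exp (- a\<^sup>2 / 2)"
      unfolding shift_density_mult_neg using True
      by (simp add: real_sqrt_mult) (simp add: real_sqrt_unique power2_eq_square exp_add[symmetric])
    also have "\<dots> \<ge> ?E t * (1 - a\<^sup>2 / 2)"
      using exp_ge_add_one_self[of "- a\<^sup>2 / 2"] E by (intro mult_left_mono) auto
    also have "?E t * (1 - a\<^sup>2 / 2) = ?E t - a\<^sup>2 / 2 * ?E t" by (simp add: algebra_simps)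
    finally show ?thesis using True mult_left_mono[OF E(2), of "a\<^sup>2 / 2"] by simp
  next
    case False
    then show ?thesis by (simp add: shift_density_def)
  qed
  with Suc show ?case by (simp add: distrib_left)
qed

section \<open>Lower bound for the cost of a single coordinate\<close>

definition coord_cost where
  "coord_cost c pred qry d X J \<theta> \<xi> r =
    c * (\<Sum>t\<in>J. (pred r (history qry d X \<theta> \<xi> r t) (X t) - ip d \<theta> (X t))\<^sup>2) +
    (\<Sum>t\<in>J. if qry r (history qry d X \<theta> \<xi> r t) (X t) then 1 else (0::real))"

lemma coord_cost_lower_bound:
  fixes pred :: "real \<Rightarrow> hist \<Rightarrow> vec \<Rightarrow> real" and c :: real
  assumes pred: "\<And>t. t < T \<Longrightarrow> (\<lambda>\<xi>. pred r (history qry d X \<theta> \<xi> r t) (X t)) \<in> borel_measurable (PiM {..<T} (\<lambda>_. gauss))"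
    and qry: "\<And>t. t < T \<Longrightarrow> Measurable.pred (PiM {..<T} (\<lambda>_. gauss)) (\<lambda>\<xi>. qry r (history qry d X \<theta> \<xi> r t) (X t))"
    and ip: "\<And>\<theta> t. t < T \<Longrightarrow> ip d \<theta> (X t) = \<theta> (f t)" and \<theta>: "\<theta> j = 0"
    and c: "c > 0" and J: "J = {t. t < T \<and> f t = j}" and \<delta>: "c * real (card J) * \<delta> ^ 4 \<le> 1"
  shows "ennreal (c * real (card J) * \<delta>\<^sup>2) \<le>
    ((\<integral>\<^sup>+\<xi>. ennreal (coord_cost c pred qry d X J (\<theta>(j := \<delta>)) \<xi> r) \<partial>PiM {..<T} (\<lambda>_. gauss)) +
     (\<integral>\<^sup>+\<xi>. ennreal (coord_cost c pred qry d X J (\<theta>(j := - \<delta>)) \<xi> r) \<partial>PiM {..<T} (\<lambda>_. gauss))) / 2"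
proof -
  let ?P = "PiM {..<T} (\<lambda>_::nat. gauss)"
  interpret prob_space gauss by (rule prob_space_gauss)
  interpret P: prob_space ?P by (intro prob_space_PiM prob_space_gauss)
  define b where "b = (\<lambda>t \<xi>. f t = j \<and> qry r (history qry d X \<theta> \<xi> r t) (X t))"
  define p where "p t \<xi> = pred r (history qry d X \<theta> \<xi> r t) (X t)" for t \<xi>
  define L where "L a = shift_density b a" for a
  define M where "M t \<xi> = (L \<delta> t \<xi> + L (- \<delta>) t \<xi>) / 2" for t \<xi>
  define n where "n = real (card J)"
  have Lpos: "L a t \<xi> > 0" for a t \<xi> unfolding L_def by (rule shift_density_pos)
  have Mpos: "M t \<xi> > 0" for t \<xi> unfolding M_def using Lpos[of \<delta> t \<xi>] Lpos[of "-\<delta>" t \<xi>] by simp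
  have b_meas: "Measurable.pred ?P (b t)" if "t < T" for t
    unfolding b_def using qry[OF that] by measurable
  have p_meas: "p t \<in> borel_measurable ?P" if "t < T" for t
    unfolding p_def using pred[OF that] .
  have L_meas: "L a t \<in> borel_measurable ?P" if "t \<le> T" for a t
    unfolding L_def using b_meas that by (intro measurable_shift_density) auto
  have past: "b t \<xi> = b t \<zeta>" if "\<And>i. i < t \<Longrightarrow> \<xi> i = \<zeta> i" for t \<xi> \<zeta>
    unfolding b_def using history_cong[of t \<xi> \<zeta>] that by metis
  have change: "(\<integral>\<^sup>+\<xi>. G (adaptive_shift b a t \<xi>) \<partial>?P) = (\<integral>\<^sup>+\<xi>. G \<xi> * ennreal (L a t \<xi>) \<partial>?P)"
    if "t \<le> T" "G \<in> borel_measurable ?P" for a t G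
    unfolding L_def using nn_integral_adaptive_shift[of T b, OF b_meas past that] by blast
  have L_int: "(\<integral>\<^sup>+\<xi>. ennreal (L a t \<xi>) \<partial>?P) = 1" if "t \<le> T" for a t
    using change[OF that, of "\<lambda>_. 1" a] P.emeasure_space_1 by simp
  have JT: "t < T" if "t \<in> J" for t using that J by simp
  have L_measJ: "L a t \<in> borel_measurable ?P" if "t \<in> J" for a t
    using L_meas less_imp_le[OF JT[OF that]] .
  have finJ: "finite J" unfolding J by simp
  have "n \<ge> 0" by (simp add: n_def)

  define h where "h a t \<xi> = c * (p t \<xi> - a)\<^sup>2 + of_bool (b t \<xi>)" for a t \<xi>
  have h0: "h a t \<xi> \<ge> 0" for a t \<xi> using c by (simp add: h_def)
  have h_meas: "h a t \<in> borel_measurable ?P" if "t < T" for a t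
    unfolding h_def using p_meas[OF that] b_meas[OF that] by measurable
  \<comment> \<open>Round \<open>t\<close> is evaluated at the shift of the rounds before
    \<open>t\<close> only: its prediction and query depend on no later label. Each round thus gets
    its own density \<open>L a t\<close>.\<close>
  have cost: "coord_cost c pred qry d X J (\<theta>(j := a)) \<xi> r = (\<Sum>t\<in>J. h a t (adaptive_shift b a t \<xi>))" for a \<xi>
    unfolding coord_cost_def sum_distrib_left sum.distrib[symmetric]
  proof (rule sum.cong[OF refl])
    fix t assume t: "t \<in> J"
    have "history qry d X (\<theta>(j := a)) \<xi> r t = history qry d X \<theta> (adaptive_shift b a t \<xi>) r t"
      by (rule history_adaptive_shift[OF b_def ip]) (use \<theta> JT[OF t] in auto)
    moreover have "f t = j" using t J by simp
    ultimately show "c * (pred r (history qry d X (\<theta>(j := a)) \<xi> r t) (X t) - ip d (\<theta>(j := a)) (X t))\<^sup>2 +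
       (if qry r (history qry d X (\<theta>(j := a)) \<xi> r t) (X t) then 1 else 0) = h a t (adaptive_shift b a t \<xi>)"
      using ip[OF JT[OF t]] by (simp add: h_def p_def b_def)
  qed
  have cost_int: "(\<integral>\<^sup>+\<xi>. ennreal (coord_cost c pred qry d X J (\<theta>(j := a)) \<xi> r) \<partial>?P) =
      (\<integral>\<^sup>+\<xi>. ennreal (\<Sum>t\<in>J. h a t \<xi> * L a t \<xi>) \<partial>?P)" for a
  proof -
    have shift_meas: "(\<lambda>\<xi>. h a t (adaptive_shift b a t \<xi>)) \<in> borel_measurable ?P" if "t \<in> J" for t
      using measurable_compose[OF measurable_adaptive_shift[OF b_meas] h_meas] JT[OF that]
      by (simp add: less_imp_le)
    have "(\<integral>\<^sup>+\<xi>. ennreal (coord_cost c pred qry d X J (\<theta>(j := a)) \<xi> r) \<partial>?P) =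
       (\<integral>\<^sup>+\<xi>. (\<Sum>t\<in>J. ennreal (h a t (adaptive_shift b a t \<xi>))) \<partial>?P)"
      unfolding cost by (simp add: sum_ennreal h0)
    also have "\<dots> = (\<Sum>t\<in>J. (\<integral>\<^sup>+\<xi>. ennreal (h a t (adaptive_shift b a t \<xi>)) \<partial>?P))"
      using shift_meas by (intro nn_integral_sum) auto
    also have "\<dots> = (\<Sum>t\<in>J. (\<integral>\<^sup>+\<xi>. ennreal (h a t \<xi>) * ennreal (L a t \<xi>) \<partial>?P))"
      using JT h_meas by (intro sum.cong refl change) (auto intro: less_imp_le)
    also have "\<dots> = (\<integral>\<^sup>+\<xi>. (\<Sum>t\<in>J. ennreal (h a t \<xi>) * ennreal (L a t \<xi>)) \<partial>?P)"
      using JT h_meas L_measJ by (intro nn_integral_sum[symmetric]) auto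
    also have "\<dots> = (\<integral>\<^sup>+\<xi>. ennreal (\<Sum>t\<in>J. h a t \<xi> * L a t \<xi>) \<partial>?P)"
      by (intro nn_integral_cong)
        (simp add: sum_ennreal[symmetric] h0 less_imp_le[OF Lpos] ennreal_mult)
    finally show ?thesis .
  qed

  \<comment> \<open>The negative \<open>M\<close> term of the loss bound is moved to the other side,
    so that all terms are nonnegative and can be integrated in \<open>ennreal\<close>. Since
    \<open>M t\<close> integrates to 1, this later costs half of the left-hand side.\<close>
  have pointwise: "2 * c * n * \<delta>\<^sup>2 \<le>
      ((\<Sum>t\<in>J. h \<delta> t \<xi> * L \<delta> t \<xi>) + (\<Sum>t\<in>J. h (- \<delta>) t \<xi> * L (- \<delta>) t \<xi>)) / 2 + (\<Sum>t\<in>J. c * \<delta>\<^sup>2 * M t \<xi>)" for \<xi>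
  proof -
    \<comment> \<open>The integral of \<open>q\<close> is the expected number of queries in
      \<open>J\<close>, averaged over the two worlds; pointwise, \<open>q\<close> is exactly the
      query part of the averaged sums of \<open>h\<close>.\<close>
    define q where "q = (\<Sum>s\<in>J. of_bool (b s \<xi>) * M s \<xi>)"
    have "q \<ge> 0" unfolding q_def by (intro sum_nonneg) (simp add: less_imp_le[OF Mpos])
    have round: "2 * \<delta>\<^sup>2 \<le> ((p t \<xi> - \<delta>)\<^sup>2 * L \<delta> t \<xi> + (p t \<xi> + \<delta>)\<^sup>2 * L (- \<delta>) t \<xi>) / 2 + \<delta>\<^sup>2 * M t \<xi> + \<delta> ^ 4 * q"
      if t: "t \<in> J" for t
    proof -
      \<comment> \<open>Rounds outside \<open>J\<close> vanish because \<open>b s\<close> includes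
        \<open>f s = j\<close>. Extending the sum to all of \<open>J\<close> gives one bound
        \<open>q\<close> for every round.\<close>
      have "(\<Sum>s<t. of_bool (b s \<xi>) * M s \<xi>) = (\<Sum>s\<in>J \<inter> {..<t}. of_bool (b s \<xi>) * M s \<xi>)"
        using JT[OF t] by (intro sum.mono_neutral_right) (auto simp: b_def J)
      also have "\<dots> \<le> q"
        unfolding q_def using finJ by (intro sum_mono2) (auto simp: less_imp_le[OF Mpos])
      finally have "1 - \<delta>\<^sup>2 / 2 * q \<le> 1 - \<delta>\<^sup>2 / 2 * (\<Sum>s<t. of_bool (b s \<xi>) * M s \<xi>)"
        by (simp add: mult_left_mono)
      also have "\<dots> \<le> sqrt (L \<delta> t \<xi> * L (- \<delta>) t \<xi>)"
        unfolding M_def L_def by (rule sqrt_shift_density_ge)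
      finally have "2 * \<delta>\<^sup>2 * (1 - \<delta>\<^sup>2 / 2 * q) \<le> 2 * \<delta>\<^sup>2 * sqrt (L \<delta> t \<xi> * L (- \<delta>) t \<xi>)"
        by (intro mult_left_mono) auto
      also have "\<dots> \<le> ((p t \<xi> - \<delta>)\<^sup>2 * L \<delta> t \<xi> + (p t \<xi> + \<delta>)\<^sup>2 * L (- \<delta>) t \<xi>) / 2 + \<delta>\<^sup>2 * M t \<xi>"
        using two_point_square_loss[of \<delta> "sqrt (L \<delta> t \<xi>)" "sqrt (L (- \<delta>) t \<xi>)" "p t \<xi>"]
          less_imp_le[OF Lpos]
        by (simp add: M_def real_sqrt_mult)
      finally show ?thesis by (simp add: algebra_simps power2_eq_square power4_eq_xxxx)
    qed
    have "2 * c * n * \<delta>\<^sup>2 = (\<Sum>t\<in>J. c * (2 * \<delta>\<^sup>2))" by (simp add: n_def)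
    also have "\<dots> \<le> (\<Sum>t\<in>J. c * (((p t \<xi> - \<delta>)\<^sup>2 * L \<delta> t \<xi> + (p t \<xi> + \<delta>)\<^sup>2 * L (- \<delta>) t \<xi>) / 2 + \<delta>\<^sup>2 * M t \<xi> + \<delta> ^ 4 * q))"
      using c round by (intro sum_mono mult_left_mono) auto
    also have "\<dots> = (\<Sum>t\<in>J. c * (((p t \<xi> - \<delta>)\<^sup>2 * L \<delta> t \<xi> + (p t \<xi> + \<delta>)\<^sup>2 * L (- \<delta>) t \<xi>) / 2)) +
        (\<Sum>t\<in>J. c * \<delta>\<^sup>2 * M t \<xi>) + (c * n * \<delta> ^ 4) * q"
      by (simp add: distrib_left sum.distrib n_def mult_ac)
    \<comment> \<open>The hypothesis on \<open>\<delta>\<close> enters: the information gained by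
      queries is paid for by their own cost \<open>q\<close>.\<close>
    also have "\<dots> \<le> (\<Sum>t\<in>J. c * (((p t \<xi> - \<delta>)\<^sup>2 * L \<delta> t \<xi> + (p t \<xi> + \<delta>)\<^sup>2 * L (- \<delta>) t \<xi>) / 2)) +
        (\<Sum>t\<in>J. c * \<delta>\<^sup>2 * M t \<xi>) + 1 * q"
      using \<delta> \<open>q \<ge> 0\<close> by (intro add_left_mono mult_right_mono) (auto simp: n_def)
    also have "\<dots> = ((\<Sum>t\<in>J. h \<delta> t \<xi> * L \<delta> t \<xi>) + (\<Sum>t\<in>J. h (- \<delta>) t \<xi> * L (- \<delta>) t \<xi>)) / 2 + (\<Sum>t\<in>J. c * \<delta>\<^sup>2 * M t \<xi>)"
      unfolding q_def M_def h_def sum.distrib[symmetric] sum_divide_distrib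
      by (simp add: sum.distrib[symmetric], intro sum.cong) (auto simp: field_simps)
    finally show ?thesis .
  qed

  define A where "A a = (\<integral>\<^sup>+\<xi>. ennreal (\<Sum>t\<in>J. h a t \<xi> * L a t \<xi>) \<partial>?P)" for a
  have S_meas: "(\<lambda>\<xi>. \<Sum>t\<in>J. h a t \<xi> * L a t \<xi>) \<in> borel_measurable ?P" for a
    using JT h_meas L_measJ by (intro borel_measurable_sum borel_measurable_times) auto
  have S0: "(\<Sum>t\<in>J. h a t \<xi> * L a t \<xi>) \<ge> 0" for a \<xi>
    by (intro sum_nonneg mult_nonneg_nonneg h0 less_imp_le[OF Lpos])
  have M_meas: "M t \<in> borel_measurable ?P" if "t \<le> T" for t
    unfolding M_def using L_meas[OF that] by (intro borel_measurable_divide borel_measurable_add) auto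
  have M_int: "(\<integral>\<^sup>+\<xi>. ennreal (M t \<xi>) \<partial>?P) = 1" if "t \<le> T" for t
  proof -
    have "(\<integral>\<^sup>+\<xi>. ennreal (M t \<xi>) \<partial>?P) = (\<integral>\<^sup>+\<xi>. (ennreal (L \<delta> t \<xi>) + ennreal (L (- \<delta>) t \<xi>)) / 2 \<partial>?P)"
      unfolding M_def
      by (intro nn_integral_cong) (simp add: divide_ennreal[symmetric] less_imp_le[OF Lpos] add_pos_pos Lpos)
    also have "\<dots> = (1 + 1) / 2"
      using L_meas[OF that] by (simp add: nn_integral_divide nn_integral_add L_int[OF that])
    finally show ?thesis by simp
  qed
  have "ennreal (2 * c * n * \<delta>\<^sup>2) = (\<integral>\<^sup>+\<xi>. ennreal (2 * c * n * \<delta>\<^sup>2) \<partial>?P)"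
    using P.emeasure_space_1 by simp
  also have "\<dots> \<le> (\<integral>\<^sup>+\<xi>. (ennreal (\<Sum>t\<in>J. h \<delta> t \<xi> * L \<delta> t \<xi>) + ennreal (\<Sum>t\<in>J. h (- \<delta>) t \<xi> * L (- \<delta>) t \<xi>)) / 2
      + (\<Sum>t\<in>J. ennreal (c * \<delta>\<^sup>2) * ennreal (M t \<xi>)) \<partial>?P)"
  proof (rule nn_integral_mono)
    fix \<xi>
    show "ennreal (2 * c * n * \<delta>\<^sup>2) \<le> (ennreal (\<Sum>t\<in>J. h \<delta> t \<xi> * L \<delta> t \<xi>) + ennreal (\<Sum>t\<in>J. h (- \<delta>) t \<xi> * L (- \<delta>) t \<xi>)) / 2
      + (\<Sum>t\<in>J. ennreal (c * \<delta>\<^sup>2) * ennreal (M t \<xi>))"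
      using ennreal_leI[OF pointwise[of \<xi>]] c S0[of \<delta> \<xi>] S0[of "-\<delta>" \<xi>]
      by (simp add: ennreal_mult[symmetric] sum_ennreal less_imp_le[OF Mpos] divide_ennreal[symmetric] sum_nonneg)
  qed
  also have "\<dots> = (A \<delta> + A (- \<delta>)) / 2 + (\<Sum>t\<in>J. ennreal (c * \<delta>\<^sup>2))"
  proof -
    have "(\<integral>\<^sup>+\<xi>. (\<Sum>t\<in>J. ennreal (c * \<delta>\<^sup>2) * ennreal (M t \<xi>)) \<partial>?P) = (\<Sum>t\<in>J. ennreal (c * \<delta>\<^sup>2))"
      using M_meas JT
      by (subst nn_integral_sum) (auto simp: nn_integral_cmult M_int less_imp_le intro!: sum.cong)
    moreover have "(\<lambda>\<xi>. \<Sum>t\<in>J. ennreal (c * \<delta>\<^sup>2) * ennreal (M t \<xi>)) \<in> borel_measurable ?P"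
      using M_meas JT by (intro borel_measurable_sum) (auto simp: less_imp_le)
    ultimately show ?thesis
      unfolding A_def using S_meas[of \<delta>] S_meas[of "-\<delta>"]
      by (simp add: nn_integral_add nn_integral_divide)
  qed
  also have "(\<Sum>t\<in>J. ennreal (c * \<delta>\<^sup>2)) = ennreal (c * n * \<delta>\<^sup>2)"
    using c by (simp add: n_def sum_ennreal del: sum_constant) (simp add: mult_ac)
  also have "(A \<delta> + A (- \<delta>)) / 2 + ennreal (c * n * \<delta>\<^sup>2) = ennreal (c * n * \<delta>\<^sup>2) + (A \<delta> + A (- \<delta>)) / 2"
    by (rule add.commute)
  also have "ennreal (2 * c * n * \<delta>\<^sup>2) = ennreal (c * n * \<delta>\<^sup>2) + ennreal (c * n * \<delta>\<^sup>2)"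
    using c \<open>n \<ge> 0\<close> by (simp add: ennreal_plus[symmetric] mult.assoc del: ennreal_plus)
  \<comment> \<open>Only the finite summand \<open>c n \<delta>^2\<close> is cancelled, so the step
    is sound even if the expected costs are infinite.\<close>
  finally have "ennreal (c * n * \<delta>\<^sup>2) \<le> (A \<delta> + A (- \<delta>)) / 2"
    unfolding ennreal_add_left_cancel_le by simp
  then show ?thesis unfolding A_def n_def cost_int .
qed

section \<open>The two-point prior and averaging over one of its coordinates\<close>

text \<open>The image of a fair coin, which covers \<open>\<delta> = 0\<close> as the point mass at
  0; the Borel sets make the product a prior on R^d.\<close>

definition two_point :: "real \<Rightarrow> real measure" where
  "two_point \<delta> = distr (measure_pmf (pmf_of_set (UNIV :: bool set))) borel (\<lambda>s. if s then \<delta> else - \<delta>)"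

lemma prob_space_two_point: "prob_space (two_point \<delta>)"
  unfolding two_point_def by (rule prob_space.prob_space_distr) (auto simp: measure_pmf.prob_space_axioms)

lemma sets_two_point [measurable_cong]: "sets (two_point \<delta>) = sets borel"
  by (simp add: two_point_def)

lemma space_two_point: "space (two_point \<delta>) = UNIV"
  by (simp add: two_point_def)

lemma nn_integral_two_point:
  assumes "f \<in> borel_measurable borel"
  shows "(\<integral>\<^sup>+x. f x \<partial>two_point \<delta>) = (f \<delta> + f (- \<delta>)) / 2"
  unfolding two_point_def using assms
  by (simp add: nn_integral_distr nn_integral_pmf_of_set UNIV_bool add.commute)

lemma AE_two_point: "AE x in two_point \<delta>. \<bar>x\<bar> = \<bar>\<delta>\<bar>"
  unfolding two_point_def by (subst AE_distr_iff) auto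

text \<open>Fubini with coordinate \<open>j\<close> innermost: averaging over its sign already gives
  \<open>B\<close> for any values of the other coordinates. Entry \<open>j\<close> is overwritten in
  both terms, so it may be set to 0, the reference world.\<close>

lemma nn_integral_PiM_two_point_ge:
  assumes I: "finite I" "j \<in> I" and g: "g \<in> borel_measurable (PiM I (\<lambda>i. two_point (\<delta> i)))"
    and B: "\<And>\<theta>. \<theta> \<in> space (PiM I (\<lambda>i. two_point (\<delta> i))) \<Longrightarrow> \<theta> j = 0 \<Longrightarrow>
      B \<le> (g (\<theta>(j := \<delta> j)) + g (\<theta>(j := - \<delta> j))) / 2"
  shows "B \<le> (\<integral>\<^sup>+\<theta>. g \<theta> \<partial>PiM I (\<lambda>i. two_point (\<delta> i)))"
proof -
  interpret product_prob_space "\<lambda>i. two_point (\<delta> i)"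
    by (simp add: product_prob_space_def product_prob_space_axioms_def product_sigma_finite_def
        prob_space_imp_sigma_finite prob_space_two_point)
  obtain K where K: "I = insert j K" "j \<notin> K" "finite K"
    using I by (metis finite_insert mk_disjoint_insert)
  interpret PK: prob_space "PiM K (\<lambda>i. two_point (\<delta> i))"
    by (intro prob_space_PiM prob_space_two_point)
  have "B = (\<integral>\<^sup>+\<theta>. B \<partial>PiM K (\<lambda>i. two_point (\<delta> i)))"
    using PK.emeasure_space_1 by simp
  also have "\<dots> \<le> (\<integral>\<^sup>+\<theta>. (\<integral>\<^sup>+x. g (\<theta>(j := x)) \<partial>two_point (\<delta> j)) \<partial>PiM K (\<lambda>i. two_point (\<delta> i)))"
  proof (rule nn_integral_mono)
    fix \<theta> assume \<theta>: "\<theta> \<in> space (PiM K (\<lambda>i. two_point (\<delta> i)))"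
    have "(\<lambda>x. \<theta>(j := x)) \<in> borel \<rightarrow>\<^sub>M PiM I (\<lambda>i. two_point (\<delta> i))"
      unfolding K by (rule measurable_fun_upd[where J = K]) (use K \<theta> in auto)
    from measurable_compose[OF this g]
    have "(\<integral>\<^sup>+x. g (\<theta>(j := x)) \<partial>two_point (\<delta> j)) = (g (\<theta>(j := \<delta> j)) + g (\<theta>(j := - \<delta> j))) / 2"
      by (rule nn_integral_two_point)
    moreover have "\<theta>(j := 0) \<in> space (PiM I (\<lambda>i. two_point (\<delta> i)))"
      using \<theta> unfolding K by (auto simp: space_PiM space_two_point PiE_def extensional_def)
    ultimately show "B \<le> (\<integral>\<^sup>+x. g (\<theta>(j := x)) \<partial>two_point (\<delta> j))"
      using B[of "\<theta>(j := 0)"] by simp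
  qed
  also have "\<dots> = (\<integral>\<^sup>+\<theta>. g \<theta> \<partial>PiM I (\<lambda>i. two_point (\<delta> i)))"
    using product_nn_integral_insert[OF K(3,2), of g] g unfolding K(1) by simp
  finally show ?thesis .
qed

section \<open>Blocks of rounds and their distribution over coordinates\<close>

lemma sum_lessThan_blocks:
  fixes f :: "nat \<Rightarrow> 'a :: comm_monoid_add" and du :: "nat \<Rightarrow> nat" and m :: nat
  shows "(\<Sum>j<(\<Sum>u<m. du u). f j) = (\<Sum>u<m. \<Sum>k<du u. f ((\<Sum>v<u. du v) + k))"
proof (induction m)
  case (Suc m)
  have "(\<Sum>j<a + b. f j) = (\<Sum>j<a. f j) + (\<Sum>k<b. f (a + k))" for a b
    by (induction b) (auto simp: add.assoc)
  with Suc show ?case by simp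
qed simp

text \<open>The points \<open>a + (q * l + k)\<close> with \<open>q < n div l\<close> all lie in the
  class. This counts the rounds that a coordinate receives when a block is dealt out
  cyclically.\<close>

lemma card_residue_class_ge:
  fixes a n l k :: nat
  assumes "k < l"
  shows "card {t \<in> {a..<a + n}. (t - a) mod l = k} \<ge> n div l"
proof -
  let ?g = "\<lambda>q. a + (q * l + k)"
  have "q * l + k < n" if "q < n div l" for q
  proof -
    have "q * l + k < (q + 1) * l" using assms by simp
    also have "\<dots> \<le> (n div l) * l" using that by (intro mult_right_mono) auto
    also have "\<dots> \<le> n" by simp
    finally show ?thesis .
  qed
  then have "?g ` {..<n div l} \<subseteq> {t \<in> {a..<a + n}. (t - a) mod l = k}"
    using assms by auto
  then have "card (?g ` {..<n div l}) \<le> card {t \<in> {a..<a + n}. (t - a) mod l = k}"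
    by (intro card_mono) auto
  moreover have "inj_on ?g {..<n div l}" using assms by (intro inj_onI) auto
  ultimately show ?thesis by (simp add: card_image)
qed

lemma block_intervals:
  fixes Tu :: "nat \<Rightarrow> nat"
  defines "I \<equiv> \<lambda>u. {(\<Sum>v<u. Tu v)..<(\<Sum>v<u. Tu v) + Tu u}"
  shows "(\<Union>u<m. I u) = {..<(\<Sum>u<m. Tu u)}" and "u \<noteq> v \<Longrightarrow> I u \<inter> I v = {}"
proof -
  show "(\<Union>u<m. I u) = {..<(\<Sum>u<m. Tu u)}"
    by (induction m) (auto simp: I_def lessThan_Suc)
  have *: "I u \<inter> I v = {}" if "u < v" for u v
  proof -
    have "(\<Sum>w<Suc u. Tu w) \<le> (\<Sum>w<v. Tu w)"
      using that by (intro sum_mono2) auto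
    then show ?thesis by (auto simp: I_def)
  qed
  show "u \<noteq> v \<Longrightarrow> I u \<inter> I v = {}"
    using *[of u v] *[of v u] by (cases u v rule: linorder_cases) auto
qed

text \<open>Disjointness of the intervals makes the block of a round unique, so a single function
  can describe the cyclic dealing in all blocks.\<close>

lemma block_schedule:
  fixes du Tu :: "nat \<Rightarrow> nat"
  defines "I \<equiv> \<lambda>u. {(\<Sum>v<u. Tu v)..<(\<Sum>v<u. Tu v) + Tu u}"
  obtains f where "\<And>u t. t \<in> I u \<Longrightarrow> f t = (\<Sum>v<u. du v) + (t - (\<Sum>v<u. Tu v)) mod du u"
proof
  define f where "f t = (let u = THE u. t \<in> I u in (\<Sum>v<u. du v) + (t - (\<Sum>v<u. Tu v)) mod du u)" for t
  fix u t assume t: "t \<in> I u"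
  have "(THE u. t \<in> I u) = u"
    using t block_intervals(2)[of _ u Tu] unfolding I_def by (intro the_equality) blast+
  then show "f t = (\<Sum>v<u. du v) + (t - (\<Sum>v<u. Tu v)) mod du u" by (simp add: f_def Let_def)
qed

section \<open>Unit vectors as features\<close>

definition unit_vec :: "nat \<Rightarrow> vec" where
  "unit_vec j = (\<lambda>i. if i = j then 1 else 0)"

lemma ip_unit_vec: "j < d \<Longrightarrow> ip d \<theta> (unit_vec j) = \<theta> j"
  by (simp add: ip_def unit_vec_def if_distrib cong: if_cong)

lemma vnorm_unit_vec: "j < d \<Longrightarrow> vnorm d (unit_vec j) = 1"
  by (simp add: vnorm_def unit_vec_def if_distrib[of "\<lambda>x. x\<^sup>2"] cong: if_cong)

lemma in_Rd_unit_vec: "j < d \<Longrightarrow> in_Rd d (unit_vec j)"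
  by (auto simp: in_Rd_def unit_vec_def)

lemma in_subspace_of_dim_unit_vecs:
  assumes "S \<subseteq> (\<lambda>k. unit_vec (a + k)) ` {..<l}" "a + l \<le> d"
  shows "in_subspace_of_dim d l S"
  unfolding in_subspace_of_dim_def
proof (intro exI conjI)
  let ?b = "\<lambda>k. unit_vec (a + k)"
  show "\<forall>j<l. in_Rd d (?b j)" using assms(2) by (auto intro: in_Rd_unit_vec)
  \<comment> \<open>Reading coordinate \<open>a + k\<close> recovers the coefficient
    \<open>w k\<close>, hence independence.\<close>
  have comb: "(\<Sum>j<l. w j * ?b j (a + k)) = w k" if "k < l" for w :: "nat \<Rightarrow> real" and k
    using that by (simp add: unit_vec_def if_distrib cong: if_cong)
  show "lin_indep_vecs d l ?b"
    unfolding lin_indep_vecs_def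
  proof (intro allI impI)
    fix w :: "nat \<Rightarrow> real" and k assume w: "\<forall>i<d. (\<Sum>j<l. w j * ?b j i) = 0" and k: "k < l"
    then show "w k = 0" using comb[OF k, of w] assms(2) by simp
  qed
  show "S \<subseteq> span_vecs d l ?b"
  proof
    fix x assume "x \<in> S"
    then obtain k where k: "k < l" "x = ?b k" using assms(1) by auto
    have "x i = (\<Sum>j<l. (if j = k then 1 else 0) * ?b j i)" for i
      using k by (simp add: if_distrib[of "\<lambda>z. z * _"] cong: if_cong)
    then show "x \<in> span_vecs d l ?b"
      using k assms(2) in_Rd_unit_vec[of "a + k" d] unfolding span_vecs_def
      by (auto intro!: exI[of _ "\<lambda>j. if j = k then 1 else 0"])
  qed
qed

section \<open>Splitting the cost by coordinates, and the loss from rounding\<close>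

lemma total_cost_eq_sum_coord_cost:
  fixes f :: "nat \<Rightarrow> nat"
  assumes "\<And>t. t < T \<Longrightarrow> f t < D"
  shows "total_cost c pred qry d T X \<theta> \<xi> r =
    (\<Sum>j<D. coord_cost c pred qry d X {t. t < T \<and> f t = j} \<theta> \<xi> r)"
proof -
  have "(\<Sum>t<T. g t) = (\<Sum>j<D. \<Sum>t\<in>{t. t < T \<and> f t = j}. g t)" for g :: "nat \<Rightarrow> real"
    using sum.group[of "{..<T}" "{..<D}" f g] assms by (simp add: image_subset_iff)
  then show ?thesis
    unfolding total_cost_def coord_cost_def regret_def num_queries_def
    by (simp add: sum.distrib sum_distrib_left)
qed

text \<open>Since \<open>l \<le> n\<close>, rounding \<open>n / l\<close> down loses at most a
  factor 2, so \<open>n \<le> 2 * l * k\<close>. Together with the 2 inside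
  \<open>sqrt (c * k / 2)\<close> this is a factor 4 under the root.\<close>

lemma sqrt_block_bound:
  fixes c :: real and l n k :: nat
  assumes "c \<ge> 0" "1 \<le> l" "l \<le> n" "n div l \<le> k"
  shows "sqrt c * sqrt (real l * real n) / 2 \<le> real l * sqrt (c * real k / 2)"
proof -
  have "n < l * (n div l + 1)" using assms(2) by (simp add: dividend_less_times_div)
  also have "l * (n div l + 1) \<le> l * (2 * k)"
    using assms div_le_mono[of l n l] by (intro mult_left_mono) auto
  finally have "real n \<le> real (l * (2 * k))" by (simp only: of_nat_le_iff less_imp_le)
  then have "real l * real n \<le> real l * (2 * real l * real k)" by (intro mult_left_mono) auto
  then have "c * (real l * real n) \<le> c * (real l * (2 * real l * real k))"
    using assms(1) by (rule mult_left_mono)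
  then have "c * (real l * real n) / 4 \<le> (real l)\<^sup>2 * (c * real k / 2)"
    by (simp add: power2_eq_square mult_ac)
  then have "sqrt (c * (real l * real n) / 4) \<le> sqrt ((real l)\<^sup>2 * (c * real k / 2))" by simp
  then show ?thesis by (simp add: real_sqrt_mult real_sqrt_divide)
qed

section \<open>The adversary and the bound on the expected total cost\<close>

theorem mainTheorem14:
  shows "\<exists>c'>0. \<forall>(\<eta>::real) (d::nat) (m::nat) (du::nat \<Rightarrow> nat) (Tu::nat \<Rightarrow> nat) (c::real).
    \<eta> \<ge> 1 \<and> d \<ge> 1 \<and> m \<ge> 1 \<and>
    (\<forall>u<m. 1 \<le> du u \<and> du u \<le> Tu u) \<and> (\<Sum>u<m. du u) \<le> d \<and>
    (\<forall>u<m. real (du u) / real (Tu u) \<le> c)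
    \<longrightarrow>
    (let T = (\<Sum>u<m. Tu u) in
     \<exists>(P::vec measure) (N::nat \<Rightarrow> real measure) (X::nat \<Rightarrow> vec).
       \<comment> \<open>(1) ground truth (drawn from the adversary's prior P, independently of everything else)\<close>
       prob_space P \<and> sets P = sets (PiM {..<d} (\<lambda>_. borel)) \<and>
       (AE \<theta> in P. vnorm d \<theta> \<le> sqrt (real d) \<and> (\<forall>t<T. \<bar>ip d \<theta> (X t)\<bar> \<le> 1)) \<and>
       \<comment> \<open>noise: independent (product measure below), zero-mean, sub-Gaussian with proxy eta^2\<close>
       (\<forall>t<T. zero_mean_subgaussian \<eta> (N t)) \<and>
       \<comment> \<open>(2) features\<close>
       (\<forall>t<T. in_Rd d (X t) \<and> vnorm d (X t) \<le> 1) \<and>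
       (\<exists>I::nat \<Rightarrow> nat set.
          (\<forall>u<m. I u \<noteq> {} \<and> finite (I u) \<and> card (I u) = Tu u) \<and>
          (\<forall>u<m. \<forall>v<m. u \<noteq> v \<longrightarrow> I u \<inter> I v = {}) \<and>
          (\<Union>u<m. I u) = {..<T} \<and>
          (\<forall>u<m. in_subspace_of_dim d (du u) (X ` I u))) \<and>
       \<comment> \<open>(3) every (measurable, possibly randomized) online active learning algorithm\<close>
       (\<forall>(S::real measure) (pred::real \<Rightarrow> hist \<Rightarrow> vec \<Rightarrow> real) (qry::real \<Rightarrow> hist \<Rightarrow> vec \<Rightarrow> bool).
          prob_space S \<and> sets S = sets borel \<and>
          (\<forall>t<T.
             (\<lambda>(r, \<theta>, \<xi>). pred r (history qry d X \<theta> \<xi> r t) (X t))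
               \<in> borel_measurable (S \<Otimes>\<^sub>M P \<Otimes>\<^sub>M PiM {..<T} N) \<and>
             (\<lambda>(r, \<theta>, \<xi>). qry r (history qry d X \<theta> \<xi> r t) (X t))
               \<in> measurable (S \<Otimes>\<^sub>M P \<Otimes>\<^sub>M PiM {..<T} N) (count_space UNIV))
          \<longrightarrow>
          (\<integral>\<^sup>+(r, \<theta>, \<xi>). ennreal (total_cost c pred qry d T X \<theta> \<xi> r)
              \<partial>(S \<Otimes>\<^sub>M P \<Otimes>\<^sub>M PiM {..<T} N))
            \<ge> ennreal (c' * sqrt c * (\<Sum>u<m. sqrt (real (du u) * real (Tu u))))))"
\<comment> \<open>The constant 1/2 is the one from \<open>sqrt_block_bound\<close>; the remaining
  steps lose nothing further.\<close>
proof (intro exI[of _ "1 / 2 :: real"] conjI allI impI)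
  fix \<eta> :: real and d m :: nat and du Tu :: "nat \<Rightarrow> nat" and c :: real
  assume H: "\<eta> \<ge> 1 \<and> d \<ge> 1 \<and> m \<ge> 1 \<and>
    (\<forall>u<m. 1 \<le> du u \<and> du u \<le> Tu u) \<and> (\<Sum>u<m. du u) \<le> d \<and>
    (\<forall>u<m. real (du u) / real (Tu u) \<le> c)"
  then have \<eta>: "\<eta> \<ge> 1" and m: "m \<ge> 1" and du: "\<And>u. u < m \<Longrightarrow> 1 \<le> du u" and Tu: "\<And>u. u < m \<Longrightarrow> du u \<le> Tu u"
    and sum_le: "(\<Sum>u<m. du u) \<le> d" and c_ge: "\<And>u. u < m \<Longrightarrow> real (du u) / real (Tu u) \<le> c"
    by auto
  define T where "T = (\<Sum>u<m. Tu u)"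
  define D where "D = (\<Sum>u<m. du u)"
  define I where "I u = {(\<Sum>v<u. Tu v)..<(\<Sum>v<u. Tu v) + Tu u}" for u
  obtain f where f: "\<And>u t. t \<in> I u \<Longrightarrow> f t = (\<Sum>v<u. du v) + (t - (\<Sum>v<u. Tu v)) mod du u"
    unfolding I_def using block_schedule[of Tu du] by blast
  have UI: "(\<Union>u<m. I u) = {..<T}" unfolding I_def T_def by (rule block_intervals)
  have DI: "I u \<inter> I v = {}" if "u \<noteq> v" for u v unfolding I_def by (rule block_intervals(2)[OF that])
  have off: "(\<Sum>v<u. du v) + du u \<le> D" if "u < m" for u
  proof -
    have "(\<Sum>v<Suc u. du v) \<le> D" unfolding D_def using that by (intro sum_mono2) auto
    then show ?thesis by simp
  qed
  have f_lt: "f t < D" if t: "t < T" for t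
  proof -
    obtain u where u: "u < m" "t \<in> I u" using t UI by auto
    have "(t - (\<Sum>v<u. Tu v)) mod du u < du u" using du[OF u(1)] by simp
    then show ?thesis using f[OF u(2)] off[OF u(1)] by linarith
  qed
  have Dd: "D \<le> d" using sum_le by (simp add: D_def)
  have c: "c > 0"
    using c_ge[of 0] du[of 0] Tu[of 0] m by (smt (verit) divide_pos_pos of_nat_0_less_iff less_le_trans zero_less_one One_nat_def Suc_le_eq)
  define J where "J j = {t. t < T \<and> f t = j}" for j
  \<comment> \<open>Coordinates without rounds get \<open>\<delta> = 0\<close>, because \<open>1 / 0 = 0\<close>.\<close>
  define \<delta> where "\<delta> j = sqrt (sqrt (1 / (2 * c * real (card (J j)))))" for j
  define X where "X t = unit_vec (f t)" for t
  define P where "P = PiM {..<d} (\<lambda>j. two_point (\<delta> j))"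
  define N :: "nat \<Rightarrow> real measure" where "N = (\<lambda>_. gauss)"
  have card_J: "Tu u div du u \<le> card (J ((\<Sum>v<u. du v) + k))" if "u < m" "k < du u" for u k
  proof -
    have "{t \<in> I u. (t - (\<Sum>v<u. Tu v)) mod du u = k} \<subseteq> J ((\<Sum>v<u. du v) + k)"
      using f UI that(1) by (auto simp: J_def)
    then have "card {t \<in> I u. (t - (\<Sum>v<u. Tu v)) mod du u = k} \<le> card (J ((\<Sum>v<u. du v) + k))"
      by (intro card_mono) (auto simp: J_def)
    then show ?thesis using card_residue_class_ge[OF that(2), of "Tu u" "\<Sum>v<u. Tu v"] by (simp add: I_def)
  qed
  \<comment> \<open>The assumption \<open>du u / Tu u \<le> c\<close> serves here to give
    \<open>\<delta> \<le> 1\<close>, and so the bounds on the ground truth. The 2 in the choice of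
    \<open>\<delta>\<close> compensates for the rounding in \<open>Tu u div du u\<close>.\<close>
  have c_card: "1 \<le> 2 * c * real (card (J (f t)))" if t: "t < T" for t
  proof -
    obtain u where u: "u < m" "t \<in> I u" using t UI by auto
    let ?k = "(t - (\<Sum>v<u. Tu v)) mod du u"
    have k: "?k < du u" using du[OF u(1)] by simp
    have "Tu u < du u * (Tu u div du u + 1)" using du[OF u(1)] by (simp add: dividend_less_times_div)
    also have "du u * (Tu u div du u + 1) \<le> du u * (2 * card (J (f t)))"
      using card_J[OF u(1) k] f[OF u(2)] du[OF u(1)] Tu[OF u(1)] div_le_mono[of "du u" "Tu u" "du u"]
      by (intro mult_left_mono) auto
    finally have "real (Tu u) \<le> real (du u * (2 * card (J (f t))))" by (simp only: of_nat_le_iff less_imp_le)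
    moreover have "real (du u) \<le> c * real (Tu u)"
      using c_ge[OF u(1)] du[OF u(1)] Tu[OF u(1)] by (simp add: divide_le_eq)
    ultimately have "real (du u) \<le> c * real (du u * (2 * card (J (f t))))"
      using c by (meson mult_left_mono less_imp_le order_trans)
    then have "real (du u) * 1 \<le> real (du u) * (2 * c * real (card (J (f t))))" by (simp add: mult_ac)
    then show ?thesis using du[OF u(1)] by (simp only: mult_le_cancel_left_pos of_nat_0_less_iff)
  qed
  have \<delta>1: "\<delta> j \<le> 1" for j
  proof (cases "J j = {}")
    case True
    then show ?thesis by (simp add: \<delta>_def)
  next
    case False
    then obtain t where "t < T" "f t = j" by (auto simp: J_def)
    then show ?thesis using c_card[of t] by (simp add: \<delta>_def divide_le_eq)
  qed
  have \<delta>0: "\<delta> j \<ge> 0" for j using c by (simp add: \<delta>_def)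
  have \<delta>2: "(\<delta> j)\<^sup>2 = sqrt (1 / (2 * c * real (card (J j))))" for j using c by (simp add: \<delta>_def)
  have \<delta>4: "c * real (card (J j)) * \<delta> j ^ 4 \<le> 1" for j
  proof -
    have "\<delta> j ^ 4 = ((\<delta> j)\<^sup>2)\<^sup>2" by (simp flip: power_mult)
    also have "\<dots> = 1 / (2 * c * real (card (J j)))" unfolding \<delta>2 using c by simp
    finally show ?thesis using c by simp
  qed
  have c\<delta>2: "c * real (card (J j)) * (\<delta> j)\<^sup>2 = sqrt (c * real (card (J j)) / 2)" for j
  proof (rule real_sqrt_unique[symmetric])
    show "(c * real (card (J j)) * (\<delta> j)\<^sup>2)\<^sup>2 = c * real (card (J j)) / 2"
      unfolding power_mult_distrib \<delta>2 using c by (simp add: power2_eq_square)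
  qed (use c in simp)
  have ip: "ip d \<theta> (X t) = \<theta> (f t)" if "t < T" for \<theta> t
    unfolding X_def using f_lt[OF that] Dd by (simp add: ip_unit_vec)

  have P_prob: "prob_space P" unfolding P_def by (intro prob_space_PiM prob_space_two_point)
  have P_sets: "sets P = sets (PiM {..<d} (\<lambda>_. borel))"
    unfolding P_def by (intro sets_PiM_cong) (auto simp: sets_two_point)
  have P_AE: "AE \<theta> in P. vnorm d \<theta> \<le> sqrt (real d) \<and> (\<forall>t<T. \<bar>ip d \<theta> (X t)\<bar> \<le> 1)"
  proof -
    have "AE \<theta> in P. \<forall>j\<in>{..<d}. \<bar>\<theta> j\<bar> \<le> 1"
    proof (rule AE_finite_allI)
      fix j assume j: "j \<in> {..<d}"
      have "AE x in two_point (\<delta> j). \<bar>x\<bar> \<le> 1"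
        using AE_two_point[of "\<delta> j"] by eventually_elim (use \<delta>0[of j] \<delta>1[of j] in auto)
      then show "AE \<theta> in P. \<bar>\<theta> j\<bar> \<le> 1"
        unfolding P_def by (intro AE_PiM_component[OF prob_space_two_point j])
    qed simp
    then show ?thesis
    proof eventually_elim
      case (elim \<theta>)
      have "(\<Sum>i<d. (\<theta> i)\<^sup>2) \<le> (\<Sum>i<d. 1)"
        using elim by (intro sum_mono) (auto simp: abs_square_le_1)
      moreover have "\<bar>ip d \<theta> (X t)\<bar> \<le> 1" if "t < T" for t
        using elim ip[OF that] f_lt[OF that] Dd by simp
      ultimately show ?case by (simp add: vnorm_def)
    qed
  qed
  have X_sub: "in_subspace_of_dim d (du u) (X ` I u)" if u: "u < m" for u
  proof (rule in_subspace_of_dim_unit_vecs)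
    show "X ` I u \<subseteq> (\<lambda>k. unit_vec ((\<Sum>v<u. du v) + k)) ` {..<du u}"
      using du[OF u] f by (auto simp: X_def intro!: image_eqI)
    show "(\<Sum>v<u. du v) + du u \<le> d" using off[OF u] Dd by simp
  qed

  have lower: "ennreal (1 / 2 * sqrt c * (\<Sum>u<m. sqrt (real (du u) * real (Tu u)))) \<le>
      (\<integral>\<^sup>+(r, \<theta>, \<xi>). ennreal (total_cost c pred qry d T X \<theta> \<xi> r) \<partial>(S \<Otimes>\<^sub>M P \<Otimes>\<^sub>M PiM {..<T} N))"
    if S: "prob_space S" "sets S = sets borel"
      and pred: "\<And>t. t < T \<Longrightarrow> (\<lambda>(r, \<theta>, \<xi>). pred r (history qry d X \<theta> \<xi> r t) (X t))
         \<in> borel_measurable (S \<Otimes>\<^sub>M P \<Otimes>\<^sub>M PiM {..<T} N)"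
      and qry: "\<And>t. t < T \<Longrightarrow> (\<lambda>(r, \<theta>, \<xi>). qry r (history qry d X \<theta> \<xi> r t) (X t))
         \<in> measurable (S \<Otimes>\<^sub>M P \<Otimes>\<^sub>M PiM {..<T} N) (count_space UNIV)"
    for S and pred :: "real \<Rightarrow> hist \<Rightarrow> vec \<Rightarrow> real" and qry :: "real \<Rightarrow> hist \<Rightarrow> vec \<Rightarrow> bool"
  proof -
    let ?Q = "PiM {..<T} N"
    let ?M = "S \<Otimes>\<^sub>M P \<Otimes>\<^sub>M ?Q"
    interpret S: prob_space S by (rule S)
    interpret P: prob_space P by (rule P_prob)
    interpret Q: prob_space ?Q unfolding N_def by (intro prob_space_PiM prob_space_gauss)
    interpret PQ: pair_prob_space P ?Q ..
    have C_meas: "(\<lambda>(r, \<theta>, \<xi>). coord_cost c pred qry d X (J j) \<theta> \<xi> r) \<in> borel_measurable ?M" for j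
    proof -
      have fst_comp: "(\<lambda>(r, \<theta>, \<xi>). \<theta> (f t)) \<in> borel_measurable ?M" if "t < T" for t
      proof -
        have ft: "f t \<in> {..<d}" using f_lt[OF that] Dd by simp
        have "(\<lambda>\<theta>. \<theta> (f t)) \<in> borel_measurable P"
          using measurable_component_singleton[OF ft, of "\<lambda>_. borel"] measurable_cong_sets[OF P_sets refl] by blast
        from measurable_compose[OF _ this, of "\<lambda>x. fst (snd x)" ?M] show ?thesis
          by (simp add: case_prod_beta')
      qed
      show ?thesis
        unfolding coord_cost_def case_prod_beta'
      proof (intro borel_measurable_add borel_measurable_times borel_measurable_const borel_measurable_sum
          borel_measurable_power borel_measurable_diff)
        fix t assume "t \<in> J j"
        then have t: "t < T" by (simp add: J_def)
        show "(\<lambda>x. pred (fst x) (history qry d X (fst (snd x)) (snd (snd x)) (fst x) t) (X t)) \<in> borel_measurable ?M"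
          using pred[OF t] by (simp add: case_prod_beta')
        show "(\<lambda>x. ip d (fst (snd x)) (X t)) \<in> borel_measurable ?M"
          using fst_comp[OF t] ip[OF t] by (simp add: case_prod_beta')
        have [measurable]: "Measurable.pred ?M (\<lambda>x. qry (fst x) (history qry d X (fst (snd x)) (snd (snd x)) (fst x) t) (X t))"
          using qry[OF t] by (simp add: case_prod_beta')
        show "(\<lambda>x. if qry (fst x) (history qry d X (fst (snd x)) (snd (snd x)) (fst x) t) (X t) then 1 else (0::real))
           \<in> borel_measurable ?M" by measurable
      qed
    qed
    have C0: "coord_cost c pred qry d X (J j) \<theta> \<xi> r \<ge> 0" for j \<theta> \<xi> r
      unfolding coord_cost_def using c by (intro add_nonneg_nonneg mult_nonneg_nonneg sum_nonneg) auto
    \<comment> \<open>By Tonelli the noise is integrated first, then the prior, then the seed. For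
      each fixed seed the learner is deterministic and the bound for one coordinate applies.\<close>
    have coord: "ennreal (sqrt (c * real (card (J j)) / 2)) \<le>
        (\<integral>\<^sup>+(r, \<theta>, \<xi>). ennreal (coord_cost c pred qry d X (J j) \<theta> \<xi> r) \<partial>?M)" if j: "j < D" for j
    proof -
      have C_meas': "(\<lambda>(\<theta>, \<xi>). ennreal (coord_cost c pred qry d X (J j) \<theta> \<xi> r)) \<in> borel_measurable (P \<Otimes>\<^sub>M ?Q)"
        if "r \<in> space S" for r
        using measurable_compose[OF measurable_Pair2[OF C_meas that] measurable_ennreal]
        by (simp add: case_prod_beta')
      have "ennreal (sqrt (c * real (card (J j)) / 2)) = (\<integral>\<^sup>+r. ennreal (sqrt (c * real (card (J j)) / 2)) \<partial>S)"
        using S.emeasure_space_1 by simp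
      also have "\<dots> \<le> (\<integral>\<^sup>+r. (\<integral>\<^sup>+\<theta>. (\<integral>\<^sup>+\<xi>. ennreal (coord_cost c pred qry d X (J j) \<theta> \<xi> r) \<partial>?Q) \<partial>P) \<partial>S)"
      proof (rule nn_integral_mono)
        fix r assume r: "r \<in> space S"
        show "ennreal (sqrt (c * real (card (J j)) / 2)) \<le>
           (\<integral>\<^sup>+\<theta>. (\<integral>\<^sup>+\<xi>. ennreal (coord_cost c pred qry d X (J j) \<theta> \<xi> r) \<partial>?Q) \<partial>P)"
          unfolding P_def
        proof (rule nn_integral_PiM_two_point_ge)
          show "j \<in> {..<d}" using j Dd by simp
          show "(\<lambda>\<theta>. \<integral>\<^sup>+\<xi>. ennreal (coord_cost c pred qry d X (J j) \<theta> \<xi> r) \<partial>?Q)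
             \<in> borel_measurable (PiM {..<d} (\<lambda>j. two_point (\<delta> j)))"
            using Q.borel_measurable_nn_integral_fst[OF C_meas'[OF r]] by (simp add: P_def)
        next
          fix \<theta> assume \<theta>: "\<theta> \<in> space (PiM {..<d} (\<lambda>j. two_point (\<delta> j)))" "\<theta> j = 0"
          show "ennreal (sqrt (c * real (card (J j)) / 2)) \<le>
             ((\<integral>\<^sup>+\<xi>. ennreal (coord_cost c pred qry d X (J j) (\<theta>(j := \<delta> j)) \<xi> r) \<partial>?Q) +
              (\<integral>\<^sup>+\<xi>. ennreal (coord_cost c pred qry d X (J j) (\<theta>(j := - \<delta> j)) \<xi> r) \<partial>?Q)) / 2"
            unfolding c\<delta>2[symmetric] N_def
          proof (rule coord_cost_lower_bound)
            \<comment> \<open>The reference \<open>\<theta>\<close> lies outside the support of the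
              prior if \<open>\<delta> j > 0\<close>, but sections of jointly measurable maps are
              measurable at every point of the space.\<close>
            have \<theta>P: "\<theta> \<in> space P" using \<theta> by (simp add: P_def)
            show "(\<lambda>\<xi>. pred r (history qry d X \<theta> \<xi> r t) (X t)) \<in> borel_measurable (PiM {..<T} (\<lambda>_. gauss))" if "t < T" for t
              using measurable_Pair2[OF measurable_Pair2[OF pred[OF that] r] \<theta>P] by (simp add: N_def)
            show "Measurable.pred (PiM {..<T} (\<lambda>_. gauss)) (\<lambda>\<xi>. qry r (history qry d X \<theta> \<xi> r t) (X t))" if "t < T" for t
              using measurable_Pair2[OF measurable_Pair2[OF qry[OF that] r] \<theta>P] by (simp add: N_def)
          qed (use ip \<theta> c \<delta>4 J_def in auto)
        qed simp
      qed
      also have "\<dots> = (\<integral>\<^sup>+r. (\<integral>\<^sup>+(\<theta>, \<xi>). ennreal (coord_cost c pred qry d X (J j) \<theta> \<xi> r) \<partial>(P \<Otimes>\<^sub>M ?Q)) \<partial>S)"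
        by (intro nn_integral_cong) (simp add: Q.nn_integral_fst[OF C_meas', symmetric])
      also have "\<dots> = (\<integral>\<^sup>+(r, \<theta>, \<xi>). ennreal (coord_cost c pred qry d X (J j) \<theta> \<xi> r) \<partial>?M)"
        using PQ.nn_integral_fst[OF measurable_compose[OF C_meas measurable_ennreal], of j]
        by (simp add: case_prod_beta')
      finally show ?thesis .
    qed
    have "1 / 2 * sqrt c * (\<Sum>u<m. sqrt (real (du u) * real (Tu u))) =
        (\<Sum>u<m. sqrt c * sqrt (real (du u) * real (Tu u)) / 2)"
      by (simp add: sum_distrib_left sum_divide_distrib)
    also have "\<dots> \<le> (\<Sum>u<m. \<Sum>k<du u. sqrt (c * real (card (J ((\<Sum>v<u. du v) + k))) / 2))"
    proof (rule sum_mono)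
      fix u assume "u \<in> {..<m}"
      then have u: "u < m" by simp
      have "sqrt c * sqrt (real (du u) * real (Tu u)) / 2 \<le> (\<Sum>k<du u. sqrt (c * real (Tu u div du u) / 2))"
        using sqrt_block_bound[of c "du u" "Tu u"] c du[OF u] Tu[OF u] by simp
      also have "\<dots> \<le> (\<Sum>k<du u. sqrt (c * real (card (J ((\<Sum>v<u. du v) + k))) / 2))"
        using card_J[OF u] c by (intro sum_mono) simp
      finally show "sqrt c * sqrt (real (du u) * real (Tu u)) / 2 \<le> \<dots>" .
    qed
    also have "\<dots> = (\<Sum>j<D. sqrt (c * real (card (J j)) / 2))"
      unfolding D_def by (rule sum_lessThan_blocks[symmetric])
    finally have "ennreal (1 / 2 * sqrt c * (\<Sum>u<m. sqrt (real (du u) * real (Tu u)))) \<le>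
        (\<Sum>j<D. ennreal (sqrt (c * real (card (J j)) / 2)))"
      using c by (subst sum_ennreal) (auto intro: ennreal_leI)
    also have "\<dots> \<le> (\<Sum>j<D. \<integral>\<^sup>+(r, \<theta>, \<xi>). ennreal (coord_cost c pred qry d X (J j) \<theta> \<xi> r) \<partial>?M)"
      using coord by (intro sum_mono) auto
    also have "\<dots> = (\<integral>\<^sup>+x. (\<Sum>j<D. case x of (r, \<theta>, \<xi>) \<Rightarrow> ennreal (coord_cost c pred qry d X (J j) \<theta> \<xi> r)) \<partial>?M)"
      using measurable_compose[OF C_meas measurable_ennreal]
      by (intro nn_integral_sum[symmetric]) (simp add: case_prod_beta')
    also have "\<dots> = (\<integral>\<^sup>+(r, \<theta>, \<xi>). ennreal (total_cost c pred qry d T X \<theta> \<xi> r) \<partial>?M)"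
      using total_cost_eq_sum_coord_cost[OF f_lt, of T] C0
      by (intro nn_integral_cong) (auto simp: sum_ennreal J_def)
    finally show ?thesis .
  qed
  show "(let T = (\<Sum>u<m. Tu u) in
     \<exists>(P::vec measure) (N::nat \<Rightarrow> real measure) (X::nat \<Rightarrow> vec).
       
       prob_space P \<and> sets P = sets (PiM {..<d} (\<lambda>_. borel)) \<and>
       (AE \<theta> in P. vnorm d \<theta> \<le> sqrt (real d) \<and> (\<forall>t<T. \<bar>ip d \<theta> (X t)\<bar> \<le> 1)) \<and>
       
       (\<forall>t<T. zero_mean_subgaussian \<eta> (N t)) \<and>
       
       (\<forall>t<T. in_Rd d (X t) \<and> vnorm d (X t) \<le> 1) \<and>
       (\<exists>I::nat \<Rightarrow> nat set.
          (\<forall>u<m. I u \<noteq> {} \<and> finite (I u) \<and> card (I u) = Tu u) \<and>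
          (\<forall>u<m. \<forall>v<m. u \<noteq> v \<longrightarrow> I u \<inter> I v = {}) \<and>
          (\<Union>u<m. I u) = {..<T} \<and>
          (\<forall>u<m. in_subspace_of_dim d (du u) (X ` I u))) \<and>
       
       (\<forall>(S::real measure) (pred::real \<Rightarrow> hist \<Rightarrow> vec \<Rightarrow> real) (qry::real \<Rightarrow> hist \<Rightarrow> vec \<Rightarrow> bool).
          prob_space S \<and> sets S = sets borel \<and>
          (\<forall>t<T.
             (\<lambda>(r, \<theta>, \<xi>). pred r (history qry d X \<theta> \<xi> r t) (X t))
               \<in> borel_measurable (S \<Otimes>\<^sub>M P \<Otimes>\<^sub>M PiM {..<T} N) \<and>
             (\<lambda>(r, \<theta>, \<xi>). qry r (history qry d X \<theta> \<xi> r t) (X t))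
               \<in> measurable (S \<Otimes>\<^sub>M P \<Otimes>\<^sub>M PiM {..<T} N) (count_space UNIV))
          \<longrightarrow>
          (\<integral>\<^sup>+(r, \<theta>, \<xi>). ennreal (total_cost c pred qry d T X \<theta> \<xi> r)
              \<partial>(S \<Otimes>\<^sub>M P \<Otimes>\<^sub>M PiM {..<T} N))
            \<ge> ennreal (1 / 2 * sqrt c * (\<Sum>u<m. sqrt (real (du u) * real (Tu u))))))"
    unfolding Let_def T_def[symmetric]
  proof (intro exI conjI)
    show "prob_space P" "sets P = sets (PiM {..<d} (\<lambda>_. borel))" by fact+
    show "AE \<theta> in P. vnorm d \<theta> \<le> sqrt (real d) \<and> (\<forall>t<T. \<bar>ip d \<theta> (X t)\<bar> \<le> 1)" by fact
    show "\<forall>t<T. zero_mean_subgaussian \<eta> (N t)"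
      using zero_mean_subgaussian_gauss[OF \<eta>] by (simp add: N_def)
    show "\<forall>t<T. in_Rd d (X t) \<and> vnorm d (X t) \<le> 1"
      using less_le_trans[OF f_lt Dd] by (simp add: X_def in_Rd_unit_vec vnorm_unit_vec)
    show "\<forall>u<m. I u \<noteq> {} \<and> finite (I u) \<and> card (I u) = Tu u"
      using du Tu by (fastforce simp: I_def)
    show "\<forall>u<m. \<forall>v<m. u \<noteq> v \<longrightarrow> I u \<inter> I v = {}" using DI by blast
    show "(\<Union>u<m. I u) = {..<T}" by (rule UI)
    show "\<forall>u<m. in_subspace_of_dim d (du u) (X ` I u)" using X_sub by blast
  qed (intro allI impI lower; blast)
qed simp

end
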